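(* Let $f(x)=x^TAx+2a^Tx+a_0$ and $g(x)=x^TBx+2b^Tx+b_0$ be two quadratic functions on $\mathbb{R}^n$, where $A,B$ are real symmetric $n\times n$ matrices, $a,b\in\mathbb{R}^n$, $a_0,b_0\in\mathbb{R}$, and suppose $B=\lambda A$ for some $\lambda\in\mathbb{R}$. If the level set $\{g=\beta\}$ separates $\{f=\alpha\}$ for some $\alpha,\beta\in\mathbb{R}$, then $d=d_+=(1,\lambda)\in\mathbb{R}^2$ or $d=d_-=(-1,-\lambda)\in\mathbb{R}^2$ satisfies all of the following four conditions: (C1) $a,b\in(\mathcal{N}(A)\cap\mathcal{N}(B))^{\perp}$; (C2) $d_2A=d_1B$, where $d=(d_1,d_2)$; (C3) $-d\in\mathbf{R}(f_H,g_H)$; (C4) for every $u\in\mathbb{R}^n$, $F_H(u)=-d$ implies $\langle F_L(u),d_\perp\rangle\neq 0$.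
   Context: For a function $h:\mathbb{R}^n\to\mathbb{R}$ and $\gamma\in\mathbb{R}$, $\{h=\gamma\}=\{x\in\mathbb{R}^n : h(x)=\gamma\}$. The level set $\{g=\beta\}$ is said to separate $\{f=\alpha\}$ if there are non-empty subsets $L^-$ and $L^+$ of $\{f=\alpha\}$ such that $L^-\cup L^+=\{f=\alpha\}$ and $(g(u^-)-\beta)(g(u^+)-\beta)<0$ for all $u^-\in L^-$ and all $u^+\in L^+$. Notation: $f_H(x)=x^TAx$, $g_H(x)=x^TBx$, $F_H(x)=(f_H(x),g_H(x))$, $F_L(x)=(a^Tx,b^Tx)$, $\mathbf{R}(f_H,g_H)=\{F_H(x) : x\in\mathbb{R}^n\}\subset\mathbb{R}^2$. For $d=(d_1,d_2)\in\mathbb{R}^2$, $d_\perp=(-d_2,d_1)$. $\mathcal{N}(P)$ is the null space of a matrix $P$, $W^\perp$ is the orthogonal complement of a subspace $W\subset\mathbb{R}^n$ for the standard inner product, and $\langle\cdot,\cdot\rangle$ is the standard inner product on $\mathbb{R}^2$. *)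

theory Defs
  imports "HOL-Analysis.Analysis"
begin

text \<open>The homogeneous quadratic part of a quadratic function. A quadratic function has linear
  part \<open>2 * (a \<bullet> x)\<close>, with the factor 2.\<close>

definition quad_form :: "real ^ 'n ^ 'n \<Rightarrow> real ^ 'n \<Rightarrow> real"
  where "quad_form A x = x \<bullet> (A *v x)"

definition quad_fun :: "real ^ 'n ^ 'n \<Rightarrow> real ^ 'n \<Rightarrow> real \<Rightarrow> real ^ 'n \<Rightarrow> real"
  where "quad_fun A a a0 x = quad_form A x + 2 * (a \<bullet> x) + a0"

definition level_set :: "('a \<Rightarrow> real) \<Rightarrow> real \<Rightarrow> 'a set"
  where "level_set h c = {x. h x = c}"

text \<open>\<open>separates g \<beta> f \<alpha>\<close>: the level set \<open>{g = \<beta>}\<close> separates \<open>{f = \<alpha>}\<close>. The notion refers to the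
  function \<open>g\<close> and the value \<open>\<beta>\<close>, not only to the set \<open>{g = \<beta>}\<close>.\<close>

definition separates :: "('a \<Rightarrow> real) \<Rightarrow> real \<Rightarrow> ('a \<Rightarrow> real) \<Rightarrow> real \<Rightarrow> bool"
  where "separates g \<beta> f \<alpha> \<longleftrightarrow>
    (\<exists>Lm Lp. Lm \<subseteq> level_set f \<alpha> \<and> Lp \<subseteq> level_set f \<alpha> \<and> Lm \<noteq> {} \<and> Lp \<noteq> {} \<and>
       Lm \<union> Lp = level_set f \<alpha> \<and>
       (\<forall>um\<in>Lm. \<forall>up\<in>Lp. (g um - \<beta>) * (g up - \<beta>) < 0))"

text \<open>The plane is \<open>real \<times> real\<close>, whose library inner product is the standard one.\<close>

definition F_H :: "real ^ 'n ^ 'n \<Rightarrow> real ^ 'n ^ 'n \<Rightarrow> real ^ 'n \<Rightarrow> real \<times> real"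
  where "F_H A B x = (quad_form A x, quad_form B x)"

definition F_L :: "real ^ 'n \<Rightarrow> real ^ 'n \<Rightarrow> real ^ 'n \<Rightarrow> real \<times> real"
  where "F_L a b x = (a \<bullet> x, b \<bullet> x)"

definition joint_range :: "real ^ 'n ^ 'n \<Rightarrow> real ^ 'n ^ 'n \<Rightarrow> (real \<times> real) set"
  where "joint_range A B = range (F_H A B)"

definition perp :: "real \<times> real \<Rightarrow> real \<times> real"
  where "perp d = (- snd d, fst d)"

definition null_space :: "real ^ 'n ^ 'm \<Rightarrow> (real ^ 'n) set"
  where "null_space P = {x. P *v x = 0}"

end

(* On {f = \<alpha>} the function g - \<beta> agrees with the affine function h(x) = c \<bullet> x - k, where
   c = 2 (b - \<lambda> a). Separation says that the hyperplane {h = 0} misses {f = \<alpha>} while {f = \<alpha>} meets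
   both of its sides, so f - \<alpha> has a constant sign on {h = 0}, positive after possibly negating f.
   Positivity makes the quadratic form A nonnegative on the orthogonal complement of c. The
   restriction of f to a segment joining two points of {f = \<alpha>} on opposite sides is a quadratic
   with value \<alpha> at both ends and a larger value in between, so A is negative somewhere. *)

theory Submission
  imports Defs
begin

lemma inner_matrix_vector_symmetric:
  fixes A :: "real ^ 'n ^ 'n"
  assumes "transpose A = A"
  shows "x \<bullet> (A *v y) = y \<bullet> (A *v x)"
  by (metis assms dot_lmul_matrix inner_commute vector_transpose_matrix)

lemma quad_form_scaleR: "quad_form A (t *\<^sub>R x) = t\<^sup>2 * quad_form A x"
  by (simp add: quad_form_def matrix_vector_mult_scaleR power2_eq_square)

lemma quad_form_scaleR_matrix: "quad_form (t *\<^sub>R A) x = t * quad_form A x"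
  by (simp add: quad_form_def scaleR_matrix_vector_assoc [symmetric])

lemma quad_form_add_null_space:
  fixes A :: "real ^ 'n ^ 'n"
  assumes "transpose A = A" and "v \<in> null_space A"
  shows "quad_form A (x + v) = quad_form A x"
  using assms inner_matrix_vector_symmetric [OF assms(1), of v x]
  by (simp add: quad_form_def null_space_def matrix_vector_right_distrib inner_add_left)

lemma quad_fun_along_line:
  fixes A :: "real ^ 'n ^ 'n"
  assumes "transpose A = A"
  shows "quad_fun A a a0 (x + t *\<^sub>R v) =
    quad_fun A a a0 x + 2 * t * (v \<bullet> (A *v x) + a \<bullet> v) + t\<^sup>2 * quad_form A v"
  using inner_matrix_vector_symmetric [OF assms, of x v]
  by (simp add: quad_fun_def quad_form_def power2_eq_square algebra_simps)

lemma minus_matrix_vector_mult: "(- A) *v x = - (A *v x)" for A :: "real ^ 'n ^ 'm"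
  using matrix_vector_mult_diff_rdistrib [of 0 A x] by simp

lemma quad_form_uminus: "quad_form (- A) x = - quad_form A x"
  by (simp add: quad_form_def minus_matrix_vector_mult)

lemma quad_fun_uminus: "quad_fun (- A) (- a) (- a0) x = - quad_fun A a a0 x"
  by (simp add: quad_fun_def quad_form_uminus)

lemma null_space_uminus: "null_space (- A) = null_space A"
  by (simp add: null_space_def minus_matrix_vector_mult)

lemma continuous_on_quad_fun: "continuous_on S (quad_fun A a a0)"
  unfolding quad_fun_def quad_form_def
  by (intro continuous_intros matrix_vector_mult_linear_continuous_on)

text \<open>The definition does not fix which of the two sets lies below \<open>\<beta>\<close>, so
  the points may be swapped. A zero of \<open>g - \<beta>\<close> on the level set would make its
  product with any point of the other, nonempty set vanish.\<close>

lemma separates_signs: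
  assumes "separates g \<beta> f \<alpha>"
  obtains x y where "f x = \<alpha>" "g x < \<beta>" "f y = \<alpha>" "\<beta> < g y" "\<And>z. f z = \<alpha> \<Longrightarrow> g z \<noteq> \<beta>"
proof -
  obtain Lm Lp where "Lm \<noteq> {}" "Lp \<noteq> {}" and L: "Lm \<union> Lp = level_set f \<alpha>"
    and prod: "\<forall>x\<in>Lm. \<forall>y\<in>Lp. (g x - \<beta>) * (g y - \<beta>) < 0"
    using assms unfolding separates_def by (elim exE conjE)
  then obtain x y where x: "x \<in> Lm" and y: "y \<in> Lp" by (meson ex_in_conv)
  have ne: "g z \<noteq> \<beta>" if "f z = \<alpha>" for z
  proof -
    have "z \<in> Lm \<union> Lp" using that L by (simp add: level_set_def)
    then show ?thesis
    proof
      assume "z \<in> Lm"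
      from prod [rule_format, OF this y] show ?thesis by auto
    next
      assume "z \<in> Lp"
      from prod [rule_format, OF x this] show ?thesis by auto
    qed
  qed
  have "x \<in> level_set f \<alpha>" "y \<in> level_set f \<alpha>"
    unfolding L [symmetric] using x y by simp_all
  then have f: "f x = \<alpha>" "f y = \<alpha>" by (simp_all add: level_set_def)
  from prod [rule_format, OF x y] have "g x < \<beta> \<and> \<beta> < g y \<or> g y < \<beta> \<and> \<beta> < g x"
    by (auto simp: mult_less_0_iff)
  then show thesis using that [OF f(1) _ f(2) _ ne] that [OF f(2) _ f(1) _ ne] by blast
qed

lemma positive_quadratic_leading_coeff:
  fixes p q r :: real
  assumes "\<And>t. r + 2 * t * q + t\<^sup>2 * p > 0"
  shows "p \<ge> 0"
proof (rule ccontr)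
  assume "\<not> p \<ge> 0"
  then have p: "p < 0" by simp
  \<comment> \<open>At this \<open>t\<close> the constant and quadratic terms cancel. What remains
    at \<open>t\<close> and \<open>- t\<close> is a number and its negative, which cannot both be
    positive.\<close>
  define t where "t = sqrt (r / - p)"
  have "r > 0" using assms [of 0] by simp
  then have "t\<^sup>2 = r / - p"
    unfolding t_def using p by (intro real_sqrt_pow2 divide_nonneg_pos) auto
  then have "t\<^sup>2 * p = - r" using p by simp
  then show False using assms [of t] assms [of "- t"] by simp
qed

lemma positive_affine_slope:
  fixes q r :: real
  assumes "\<And>t. r + 2 * t * q > 0"
  shows "q = 0"
  using assms [of "- r / (2 * q)"] by (cases "q = 0") auto

lemma segment_meets_hyperplane:
  fixes c :: "'a::real_inner"
  assumes "c \<bullet> x < k" and "k < c \<bullet> y"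
  obtains t where "0 < t" "t < 1" "c \<bullet> (x + t *\<^sub>R (y - x)) = k"
proof
  let ?t = "(k - c \<bullet> x) / (c \<bullet> y - c \<bullet> x)"
  show "0 < ?t" "?t < 1" using assms by auto
  show "c \<bullet> (x + ?t *\<^sub>R (y - x)) = k"
    using assms by (simp add: inner_add_right inner_diff_right)
qed

text \<open>All information about \<open>g\<close> is carried by the hyperplane given by
  \<open>c\<close> and \<open>k\<close>. Only the positive sign is treated; the other one is reached
  by negating \<open>A\<close>, \<open>a\<close>, \<open>a0\<close> and
  \<open>\<alpha>\<close>.\<close>

context
  fixes A :: "real ^ 'n ^ 'n" and a c x y :: "real ^ 'n" and a0 \<alpha> k :: real
  assumes sym: "transpose A = A"
    and pos: "\<And>z. c \<bullet> z = k \<Longrightarrow> quad_fun A a a0 z > \<alpha>"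
    and fx: "quad_fun A a a0 x = \<alpha>" and fy: "quad_fun A a a0 y = \<alpha>"
    and cx: "c \<bullet> x < k" and cy: "k < c \<bullet> y"
begin

text \<open>A line with direction \<open>u\<close> through a point of the hyperplane stays in it, so
  \<open>f - \<alpha>\<close> is a positive quadratic polynomial along it, with leading coefficient
  \<open>quad_form A u\<close>.\<close>

lemma quad_form_nonneg_on_hyperplane:
  assumes "c \<bullet> u = 0"
  shows "quad_form A u \<ge> 0"
proof -
  obtain s where s: "c \<bullet> (x + s *\<^sub>R (y - x)) = k"
    using segment_meets_hyperplane [OF cx cy] by blast
  let ?p = "x + s *\<^sub>R (y - x)"
  have "(quad_fun A a a0 ?p - \<alpha>) + 2 * t * (u \<bullet> (A *v ?p) + a \<bullet> u) + t\<^sup>2 * quad_form A u > 0"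
    for t
  proof -
    have "c \<bullet> (?p + t *\<^sub>R u) = k"
      using s assms by (simp only: inner_add_right [of _ ?p] inner_scaleR_right)
    from pos [OF this] show ?thesis
      unfolding quad_fun_along_line [OF sym, of a a0 ?p] by linarith
  qed
  then show ?thesis by (rule positive_quadratic_leading_coeff)
qed

lemma quad_form_chord_negative: "quad_form A (y - x) < 0"
proof -
  let ?q = "quad_form A (y - x)" and ?m = "(y - x) \<bullet> (A *v x) + a \<bullet> (y - x)"
  obtain t where t: "0 < t" "t < 1" "c \<bullet> (x + t *\<^sub>R (y - x)) = k"
    using segment_meets_hyperplane [OF cx cy] by blast
  \<comment> \<open>Equal values at both ends of the chord determine the linear coefficient; the
    excess over \<open>\<alpha>\<close> at parameter \<open>t\<close> becomes
    \<open>t * (1 - t) * (- ?q)\<close>.\<close>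
  have m: "2 * ?m = - ?q"
    using quad_fun_along_line [OF sym, of a a0 x 1 "y - x"] fx fy by simp
  have "0 < t * (2 * ?m) + t\<^sup>2 * ?q"
    using pos [OF t(3)] fx unfolding quad_fun_along_line [OF sym] by (simp add: algebra_simps)
  also have "\<dots> = t * (1 - t) * (- ?q)"
    unfolding m by (simp add: algebra_simps power2_eq_square)
  finally have "0 < t * (1 - t) * (- ?q)" .
  then show ?thesis using t by (simp add: zero_less_mult_iff mult_less_0_iff)
qed

lemma quad_form_attains_minus_one: "\<exists>u. quad_form A u = - 1"
proof
  show "quad_form A ((1 / sqrt (- quad_form A (y - x))) *\<^sub>R (y - x)) = - 1"
    using quad_form_chord_negative by (simp add: quad_form_scaleR power_divide)
qed

text \<open>Adding null vectors does not change the form. If \<open>v\<close> were transversal to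
  the hyperplane, a multiple of it would move the negative chord direction into the orthogonal
  complement of \<open>c\<close>, where the form is nonnegative.\<close>

lemma null_space_orthogonal_normal:
  assumes v: "v \<in> null_space A"
  shows "c \<bullet> v = 0"
proof (rule ccontr)
  assume cv: "c \<bullet> v \<noteq> 0"
  define s where "s = - (c \<bullet> (y - x)) / (c \<bullet> v)"
  have "s *\<^sub>R v \<in> null_space A"
    using v by (simp add: null_space_def matrix_vector_mult_scaleR)
  then have "quad_form A ((y - x) + s *\<^sub>R v) = quad_form A (y - x)"
    by (rule quad_form_add_null_space [OF sym])
  moreover have "c \<bullet> ((y - x) + s *\<^sub>R v) = 0"
    using cv by (simp add: s_def inner_add_right inner_diff_right)
  ultimately show False
    using quad_form_nonneg_on_hyperplane [of "(y - x) + s *\<^sub>R v"] quad_form_chord_negative by simp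
qed

text \<open>By the previous lemma \<open>v\<close> is parallel to the hyperplane. Along such a line
  inside it, \<open>f\<close> is affine and bounded below, hence constant.\<close>

lemma null_space_orthogonal_linear_part:
  assumes v: "v \<in> null_space A"
  shows "a \<bullet> v = 0"
proof -
  obtain s where s: "c \<bullet> (x + s *\<^sub>R (y - x)) = k"
    using segment_meets_hyperplane [OF cx cy] by blast
  let ?p = "x + s *\<^sub>R (y - x)"
  have Av: "A *v v = 0" using v by (simp add: null_space_def)
  have "(quad_fun A a a0 ?p - \<alpha>) + 2 * t * (a \<bullet> v) > 0" for t
  proof -
    have "c \<bullet> (?p + t *\<^sub>R v) = k"
      using s null_space_orthogonal_normal [OF v]
      by (simp only: inner_add_right [of _ ?p] inner_scaleR_right)
    from pos [OF this] show ?thesis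
      using inner_matrix_vector_symmetric [OF sym, of v ?p] Av
      unfolding quad_fun_along_line [OF sym, of a a0 ?p] quad_form_def by simp
  qed
  then show ?thesis by (rule positive_affine_slope)
qed

end

lemma quad_fun_constant_sign_on_hyperplane:
  assumes "\<And>z. c \<bullet> z = k \<Longrightarrow> quad_fun A a a0 z \<noteq> \<alpha>"
  shows "(\<forall>z. c \<bullet> z = k \<longrightarrow> quad_fun A a a0 z > \<alpha>) \<or> (\<forall>z. c \<bullet> z = k \<longrightarrow> quad_fun A a a0 z < \<alpha>)"
proof (rule ccontr)
  let ?H = "{z. c \<bullet> z = k}"
  assume "\<not> ?thesis"
  then obtain p q where pq: "p \<in> ?H" "q \<in> ?H" "quad_fun A a a0 p \<le> \<alpha>" "\<alpha> \<le> quad_fun A a a0 q"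
    by (auto simp: not_less)
  have "connected (quad_fun A a a0 ` ?H)"
    by (intro connected_continuous_image continuous_on_quad_fun convex_connected convex_hyperplane)
  \<comment> \<open>On the real line the inner product with 1 is the identity, so this is the
    intermediate value theorem.\<close>
  from connected_ivt_hyperplane [OF this imageI [OF pq(1)] imageI [OF pq(2)], of 1 \<alpha>] pq
  obtain z where "z \<in> ?H" "quad_fun A a a0 z = \<alpha>" by auto
  with assms show False by simp
qed

theorem theorem5p2:
  fixes A B :: "real ^ 'n ^ 'n"
    and a b :: "real ^ 'n"
    and a0 b0 \<alpha> \<beta> lam :: real
  assumes "transpose A = A" and "transpose B = B"
    and "B = lam *\<^sub>R A"
    and "separates (quad_fun B b b0) \<beta> (quad_fun A a a0) \<alpha>"
  shows "\<exists>d \<in> {(1, lam), (- 1, - lam)}.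
      a \<in> orthogonal_comp (null_space A \<inter> null_space B) \<and>
      b \<in> orthogonal_comp (null_space A \<inter> null_space B) \<and>
      snd d *\<^sub>R A = fst d *\<^sub>R B \<and>
      - d \<in> joint_range A B \<and>
      (\<forall>u. F_H A B u = - d \<longrightarrow> F_L a b u \<bullet> perp d \<noteq> 0)"
proof -
  define c where "c = 2 *\<^sub>R (b - lam *\<^sub>R a)"
  \<comment> \<open>Both constants come from eliminating the quadratic part of \<open>g\<close> by
    means of \<open>f z = \<alpha>\<close>.\<close>
  define k where "k = lam * (a0 - \<alpha>) + \<beta> - b0"
  have g: "quad_fun B b b0 z = \<beta> + (c \<bullet> z - k)" if "quad_fun A a a0 z = \<alpha>" for z
  proof -
    have "quad_form A z = \<alpha> - 2 * (a \<bullet> z) - a0"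
      using that by (simp add: quad_fun_def)
    then have "quad_fun B b b0 z = lam * (\<alpha> - 2 * (a \<bullet> z) - a0) + 2 * (b \<bullet> z) + b0"
      by (simp add: quad_fun_def assms(3) quad_form_scaleR_matrix)
    then show ?thesis
      by (simp add: c_def k_def algebra_simps)
  qed
  have side: "quad_fun B b b0 z < \<beta> \<longleftrightarrow> c \<bullet> z < k" "\<beta> < quad_fun B b b0 z \<longleftrightarrow> k < c \<bullet> z"
    "quad_fun B b b0 z = \<beta> \<longleftrightarrow> c \<bullet> z = k" if "quad_fun A a a0 z = \<alpha>" for z
    unfolding g [OF that] by auto
  obtain x y where "quad_fun A a a0 x = \<alpha>" "quad_fun B b b0 x < \<beta>"
    "quad_fun A a a0 y = \<alpha>" "\<beta> < quad_fun B b b0 y"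
    and g_ne: "\<And>z. quad_fun A a a0 z = \<alpha> \<Longrightarrow> quad_fun B b b0 z \<noteq> \<beta>"
    using separates_signs [OF assms(4)] by metis
  then have x: "quad_fun A a a0 x = \<alpha>" "c \<bullet> x < k" and y: "quad_fun A a a0 y = \<alpha>" "k < c \<bullet> y"
    using side by simp_all
  have ne: "quad_fun A a a0 z \<noteq> \<alpha>" if "c \<bullet> z = k" for z
    using g_ne [of z] side(3) [of z] that by auto

  \<comment> \<open>The sign \<open>e\<close> selects \<open>d = (e, lam * e)\<close>. Since
    \<open>B\<close> is a multiple of \<open>A\<close>, the conditions on \<open>d\<close> reduce to
    facts about \<open>A\<close>, \<open>a\<close> and \<open>c\<close>.\<close>
  have conclude: ?thesis
    if "e = 1 \<or> e = - 1" and Q: "\<exists>u. quad_form A u = - e"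
      and C: "\<And>u. quad_form A u = - e \<Longrightarrow> c \<bullet> u \<noteq> 0"
      and N: "\<And>v. v \<in> null_space A \<Longrightarrow> c \<bullet> v = 0" "\<And>v. v \<in> null_space A \<Longrightarrow> a \<bullet> v = 0" for e
  proof (rule bexI [of _ "(e, lam * e)"])
    have "b \<bullet> v = 0" if "v \<in> null_space A" for v
      using N that by (auto simp: c_def inner_diff_left)
    with N(2) have "a \<in> orthogonal_comp (null_space A \<inter> null_space B)"
      "b \<in> orthogonal_comp (null_space A \<inter> null_space B)"
      by (auto simp: orthogonal_comp_def orthogonal_def inner_commute)
    moreover have "- (e, lam * e) \<in> joint_range A B"
    proof -
      obtain u where "quad_form A u = - e" using Q by blast
      then have "F_H A B u = - (e, lam * e)"
        by (simp add: F_H_def assms(3) quad_form_scaleR_matrix)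
      then show ?thesis by (metis joint_range_def rangeI)
    qed
    moreover have "F_L a b u \<bullet> perp (e, lam * e) \<noteq> 0" if "F_H A B u = - (e, lam * e)" for u
    proof -
      \<comment> \<open>Up to the factor \<open>e / 2\<close>, the pairing in (C4) is the linear
        form given by the hyperplane normal.\<close>
      have "2 * (F_L a b u \<bullet> perp (e, lam * e)) = e * (c \<bullet> u)"
        by (simp add: F_L_def perp_def c_def algebra_simps)
      moreover have "c \<bullet> u \<noteq> 0" using C [of u] that by (simp add: F_H_def)
      ultimately show ?thesis using \<open>e = 1 \<or> e = - 1\<close> by auto
    qed
    ultimately show "a \<in> orthogonal_comp (null_space A \<inter> null_space B) \<and>
      b \<in> orthogonal_comp (null_space A \<inter> null_space B) \<and>
      snd (e, lam * e) *\<^sub>R A = fst (e, lam * e) *\<^sub>R B \<and>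
      - (e, lam * e) \<in> joint_range A B \<and>
      (\<forall>u. F_H A B u = - (e, lam * e) \<longrightarrow> F_L a b u \<bullet> perp (e, lam * e) \<noteq> 0)"
      by (auto simp: assms(3) mult.commute)
  qed (use that(1) in auto)

  consider "\<And>z. c \<bullet> z = k \<Longrightarrow> quad_fun A a a0 z > \<alpha>" | "\<And>z. c \<bullet> z = k \<Longrightarrow> quad_fun A a a0 z < \<alpha>"
    using quad_fun_constant_sign_on_hyperplane [of c k A a a0 \<alpha>] ne by blast
  then show ?thesis
  proof cases
    case 1
    note hyps = assms(1) 1 x(1) y(1) x(2) y(2)
    show ?thesis
    proof (rule conclude [of 1])
      show "c \<bullet> u \<noteq> 0" if "quad_form A u = - 1" for u
        using quad_form_nonneg_on_hyperplane [OF hyps, of u] that by auto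
    qed (use quad_form_attains_minus_one [OF hyps] null_space_orthogonal_normal [OF hyps]
        null_space_orthogonal_linear_part [OF hyps] in auto)
  next
    case 2
    \<comment> \<open>Negating \<open>f\<close> leaves \<open>c\<close>, \<open>k\<close> and the
      sides of \<open>x\<close> and \<open>y\<close> unchanged, so the same lemmas apply and give
      \<open>e = - 1\<close>.\<close>
    have neg: "transpose (- A) = - A"
      using assms(1) by (simp add: transpose_def vec_eq_iff)
    have pos: "quad_fun (- A) (- a) (- a0) z > - \<alpha>" if "c \<bullet> z = k" for z
      using 2 [OF that] by (simp add: quad_fun_uminus)
    have vals: "quad_fun (- A) (- a) (- a0) x = - \<alpha>" "quad_fun (- A) (- a) (- a0) y = - \<alpha>"
      using x y by (simp_all add: quad_fun_uminus)
    note hyps = neg pos vals x(2) y(2)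
    show ?thesis
    proof (rule conclude [of "- 1"])
      show "c \<bullet> u \<noteq> 0" if "quad_form A u = - (- 1)" for u
        using quad_form_nonneg_on_hyperplane [OF hyps, of u] that by (auto simp: quad_form_uminus)
    qed (use quad_form_attains_minus_one [OF hyps] null_space_orthogonal_normal [OF hyps]
        null_space_orthogonal_linear_part [OF hyps]
        in \<open>auto simp: quad_form_uminus null_space_uminus\<close>)
  qed
qed

end
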